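(* Let $n \ge 2$ be an integer. Among all pairs of probability vectors $p=(p_1,\dots,p_n)$ and $q=(q_1,\dots,q_n)$ (that is, $p_i,q_i\ge 0$ for all $i$ and $\sum_{i=1}^n p_i=\sum_{i=1}^n q_i=1$), the quantity $D=\sum_{j=2}^{2n}\left(c_j-\frac{1}{2n-1}\right)^2$, where $c_j=\sum_{i+k=j,\ 1\le i,k\le n}p_i q_k$, attains its minimum, and $D$ is minimized by $(p,q)$ if and only if either (1) $p_1=p_n=\frac12$, $p_i=0$ for $2\le i\le n-1$, $q_1=q_n=\frac{2}{3n-2}$, and $q_i=\frac{3}{3n-2}$ for $2\le i\le n-1$; or (2) the same holds with the roles of $p$ and $q$ swapped: $q_1=q_n=\frac12$, $q_i=0$ for $2\le i\le n-1$, $p_1=p_n=\frac{2}{3n-2}$, and $p_i=\frac{3}{3n-2}$ for $2\le i\le n-1$. The minimum value of $D$ is $\frac{1}{2(2n-1)(3n-2)}$, and it corresponds to $c_2=c_{2n}=\frac{1}{3n-2}$, $c_{n+1}=\frac{2}{3n-2}$, and $c_j=\frac{3}{2(3n-2)}$ for all $j\in\{2,3,\dots,2n\}\setminus\{2,n+1,2n\}$.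
   Context: Two independent, possibly unfair, $n$-sided dice have sides labelled $1,\dots,n$. $p_i$ (respectively $q_i$) is the probability that the first (respectively second) die lands on side $i$. $c_j$ is the probability that the sum of the two dice equals $j$, for $j=2,3,\dots,2n$. $D$ is the sum of squared differences between the distribution of the sum and the uniform distribution on $\{2,\dots,2n\}$. *)

theory Defs
  imports Complex_Main
begin

text \<open>
  A vector \<open>(p\<^sub>1, \<dots>, p\<^sub>n)\<close> is a function \<open>nat \<Rightarrow> real\<close> of which only the values on \<open>{1..n}\<close>
  matter; values outside \<open>{1..n}\<close> are neither constrained nor used.
\<close>

definition prob_vec :: "nat \<Rightarrow> (nat \<Rightarrow> real) \<Rightarrow> bool" where
  "prob_vec n p \<longleftrightarrow> (\<forall>i\<in>{1..n}. 0 \<le> p i) \<and> (\<Sum>i=1..n. p i) = 1"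

definition sum_prob :: "nat \<Rightarrow> (nat \<Rightarrow> real) \<Rightarrow> (nat \<Rightarrow> real) \<Rightarrow> nat \<Rightarrow> real" where
  "sum_prob n p q j = (\<Sum>(i, k)\<in>{(i, k). i \<in> {1..n} \<and> k \<in> {1..n} \<and> i + k = j}. p i * q k)"

definition discrepancy :: "nat \<Rightarrow> (nat \<Rightarrow> real) \<Rightarrow> (nat \<Rightarrow> real) \<Rightarrow> real" where
  "discrepancy n p q = (\<Sum>j=2..2 * n. (sum_prob n p q j - 1 / (2 * real n - 1))\<^sup>2)"

definition minimizes_discrepancy :: "nat \<Rightarrow> (nat \<Rightarrow> real) \<Rightarrow> (nat \<Rightarrow> real) \<Rightarrow> bool" where
  "minimizes_discrepancy n p q \<longleftrightarrow>
     is_arg_min (\<lambda>(p, q). discrepancy n p q) (\<lambda>(p, q). prob_vec n p \<and> prob_vec n q) (p, q)"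

end

theory Submission
  imports Defs
begin

text \<open>
  Write \<open>N = 3 n - 2\<close> and let \<open>c\<close> be the distribution of the sum. As \<open>c\<close> has total mass one,
  minimizing the discrepancy means minimizing \<open>\<Sum> c\<^sub>j\<^sup>2\<close>. The only obstruction to uniformity that
  matters is that both ends \<open>c\<^sub>2 = p\<^sub>1 q\<^sub>1\<close> and \<open>c\<^sub>2\<^sub>n = p\<^sub>n q\<^sub>n\<close> being large forces the middle to be
  large: \<open>c\<^sub>n\<^sub>+\<^sub>1 \<ge> p\<^sub>1 q\<^sub>n + p\<^sub>n q\<^sub>1\<close>, so that \<open>c\<^sub>n\<^sub>+\<^sub>1\<^sup>2 \<ge> 4 c\<^sub>2 c\<^sub>2\<^sub>n\<close> by the inequality of arithmetic
  and geometric means.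

  Under that single constraint the minimum can be read off from an identity
  (\<open>discrepancy_excess\<close>): the difference between the discrepancy and the claimed minimum is
  a sum of positive multiples of squares and of \<open>c\<^sub>n\<^sub>+\<^sub>1\<^sup>2 - 4 c\<^sub>2 c\<^sub>2\<^sub>n\<close>. Hence the claimed value is a
  lower bound, and it is attained exactly by the distribution described in \<open>optimal_profile\<close>.

  It remains to see which pairs of dice produce this distribution. Its middle value is exactly
  twice its end values, which leaves no slack in the estimate above: the dice satisfy
  \<open>p\<^sub>1 = p\<^sub>n\<close>, \<open>q\<^sub>1 = q\<^sub>n\<close>, and \<open>p\<^sub>i q\<^sub>n\<^sub>+\<^sub>1\<^sub>-\<^sub>i = 0\<close> at all inner sides. By the last condition
  an inner side of \<open>p\<close> and the opposite side of \<open>q\<close> are never both in use. Since inner weights of \<open>p\<close>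
  and \<open>q\<close> that each supply their value \<open>3 / (2 N)\<close> of the distribution alone would multiply to
  \<open>9 / (4 N)\<close>, more than the largest value \<open>2 / N\<close>, only one of the two dice
  has inner weights (\<open>inner_weights_vanish\<close>). So the other die is a fair coin on \<open>{1, n}\<close>, and the
  distribution of the sum then determines everything.
\<close>

section \<open>The distribution of the sum of two dice\<close>

lemma finite_sum_pairs:
  "finite {(i, k). i \<in> {1..n} \<and> k \<in> {1..n} \<and> i + k = (j::nat)}"
  by (rule finite_subset[of _ "{1..n} \<times> {1..n}"]) auto

lemma sum_prob_commute: "sum_prob n p q = sum_prob n q p"
  unfolding sum_prob_def
  by (rule ext, rule sum.reindex_bij_witness[where i = prod.swap and j = prod.swap]) auto

text \<open>
  Turning both dice upside down reverses the distribution of the sum; this transfers statements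
  about small sums to large ones.
\<close>
lemma sum_prob_reflect:
  assumes "j \<le> 2 * n + 2"
  shows "sum_prob n (\<lambda>i. p (n + 1 - i)) (\<lambda>i. q (n + 1 - i)) (2 * n + 2 - j) = sum_prob n p q j"
  unfolding sum_prob_def using assms
  by (intro sum.reindex_bij_witness[where
        i = "\<lambda>(i, k). (n + 1 - i, n + 1 - k)" and j = "\<lambda>(i, k). (n + 1 - i, n + 1 - k)"]) auto

lemma sum_prob_total:
  "(\<Sum>j=2..2 * n. sum_prob n p q j) = (\<Sum>i=1..n. p i) * (\<Sum>k=1..n. q k)"
proof -
  let ?S = "{1..n} \<times> {1..n}"
  let ?h = "\<lambda>(i, k). p i * q k"
  have "(\<Sum>j=2..2 * n. sum_prob n p q j) = (\<Sum>j=2..2 * n. sum ?h {x \<in> ?S. fst x + snd x = j})"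
    unfolding sum_prob_def by (intro sum.cong) auto
  also have "\<dots> = sum ?h ?S"
    by (intro sum.group) auto
  also have "\<dots> = (\<Sum>i=1..n. p i) * (\<Sum>k=1..n. q k)"
    by (simp add: sum_product sum.cartesian_product)
  finally show ?thesis .
qed

lemma sum_le_sum_prob:
  assumes "prob_vec n p" "prob_vec n q"
    and "A \<subseteq> {(i, k). i \<in> {1..n} \<and> k \<in> {1..n} \<and> i + k = j}"
  shows "(\<Sum>(i, k)\<in>A. p i * q k) \<le> sum_prob n p q j"
  unfolding sum_prob_def using assms
  by (intro sum_mono2 finite_sum_pairs) (auto simp: prob_vec_def)

lemma sum_prob_2:
  assumes "n \<ge> 1"
  shows "sum_prob n p q 2 = p 1 * q 1"
proof -
  have "{(i, k). i \<in> {1..n} \<and> k \<in> {1..n} \<and> i + k = 2} = {(1, 1)}"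
    using assms by auto
  then show ?thesis by (simp add: sum_prob_def)
qed

lemma sum_prob_2n:
  assumes "n \<ge> 1"
  shows "sum_prob n p q (2 * n) = p n * q n"
proof -
  have "{(i, k). i \<in> {1..n} \<and> k \<in> {1..n} \<and> i + k = 2 * n} = {(n, n)}"
    using assms by auto
  then show ?thesis by (simp add: sum_prob_def)
qed

text \<open>
  The next two lemmas are the step of the induction from both ends towards the middle: once the
  outer inner sides of \<open>p\<close> are known to be empty, a value of the distribution involves only one
  new side of each die.
\<close>
lemma sum_prob_low:
  assumes "2 \<le> k" "k \<le> n" and zero: "\<And>i. 1 < i \<Longrightarrow> i < k \<Longrightarrow> p i = 0"
  shows "sum_prob n p q (k + 1) = p 1 * q k + p k * q 1"
proof -
  have "sum_prob n p q (k + 1) = (\<Sum>(i, l)\<in>{(1, k), (k, 1)}. p i * q l)"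
    unfolding sum_prob_def
  proof (rule sum.mono_neutral_right)
    show "\<forall>x\<in>{(i, l). i \<in> {1..n} \<and> l \<in> {1..n} \<and> i + l = k + 1} - {(1, k), (k, 1)}.
            (case x of (i, l) \<Rightarrow> p i * q l) = 0"
    proof
      fix x assume x: "x \<in> {(i, l). i \<in> {1..n} \<and> l \<in> {1..n} \<and> i + l = k + 1} - {(1, k), (k, 1)}"
      obtain i l where il: "x = (i, l)" by (cases x)
      then have "1 < i" "i < k" using x by auto
      then show "(case x of (i, l) \<Rightarrow> p i * q l) = 0" using zero il by simp
    qed
  qed (rule finite_sum_pairs, use assms in auto)
  then show ?thesis using assms by simp
qed

lemma sum_prob_high:
  assumes "2 \<le> k" "k \<le> n" and zero: "\<And>i. 1 < i \<Longrightarrow> i < k \<Longrightarrow> p (n + 1 - i) = 0"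
  shows "sum_prob n p q (2 * n + 1 - k) = p n * q (n + 1 - k) + p (n + 1 - k) * q n"
proof -
  have "sum_prob n p q (2 * n + 1 - k) =
      sum_prob n (\<lambda>i. p (n + 1 - i)) (\<lambda>i. q (n + 1 - i)) (k + 1)"
    using sum_prob_reflect[of "2 * n + 1 - k" n p q] assms(1,2) by (simp add: Suc_diff_le)
  also have "\<dots> = p n * q (n + 1 - k) + p (n + 1 - k) * q n"
    using sum_prob_low[of k n "\<lambda>i. p (n + 1 - i)" "\<lambda>i. q (n + 1 - i)"] assms by simp
  finally show ?thesis .
qed

section \<open>The lower bound for the discrepancy\<close>

definition min_discrepancy :: "nat \<Rightarrow> real" where
  "min_discrepancy n = 1 / (2 * (2 * real n - 1) * (3 * real n - 2))"

definition optimal_profile :: "nat \<Rightarrow> (nat \<Rightarrow> real) \<Rightarrow> bool" where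
  "optimal_profile n c \<longleftrightarrow>
     c 2 = 1 / (3 * real n - 2) \<and> c (2 * n) = 1 / (3 * real n - 2) \<and>
     c (n + 1) = 2 / (3 * real n - 2) \<and>
     (\<forall>j\<in>{2..2 * n} - {2, n + 1, 2 * n}. c j = 3 / (2 * (3 * real n - 2)))"

lemma middle_square_ge:
  assumes "n \<ge> 2" "prob_vec n p" "prob_vec n q"
  shows "p 1 * q n + p n * q 1 \<le> sum_prob n p q (n + 1)"
    and "4 * sum_prob n p q 2 * sum_prob n p q (2 * n) \<le> (sum_prob n p q (n + 1))\<^sup>2"
proof -
  have nonneg: "0 \<le> p 1" "0 \<le> p n" "0 \<le> q 1" "0 \<le> q n"
    using assms by (auto simp: prob_vec_def)
  show le: "p 1 * q n + p n * q 1 \<le> sum_prob n p q (n + 1)"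
    using sum_le_sum_prob[OF assms(2,3), of "{(1, n), (n, 1)}" "n + 1"] assms(1) by simp
  have "4 * (p 1 * q 1) * (p n * q n) \<le> (p 1 * q n + p n * q 1)\<^sup>2"
    using zero_le_power2[of "p 1 * q n - p n * q 1"]
    by (simp add: power2_eq_square algebra_simps)
  also have "\<dots> \<le> (sum_prob n p q (n + 1))\<^sup>2"
    using nonneg le by (intro power_mono) auto
  finally show "4 * sum_prob n p q 2 * sum_prob n p q (2 * n) \<le> (sum_prob n p q (n + 1))\<^sup>2"
    using assms(1) by (simp add: sum_prob_2 sum_prob_2n)
qed

text \<open>
  The sum over the inner values is their squared distance to the optimal value \<open>3 / (2 N)\<close>. What
  remains is a quadratic in \<open>a = c\<^sub>2\<close>, \<open>b = c\<^sub>2\<^sub>n\<close>, \<open>z = c\<^sub>n\<^sub>+\<^sub>1\<close>, for which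
  \<open>a\<^sup>2 + b\<^sup>2 + z\<^sup>2 - 3/8 (a + b + z)\<^sup>2 = 1/4 (a - b)\<^sup>2 + 1/4 (z\<^sup>2 - 4 a b) + 3/8 (a + b - z)\<^sup>2\<close>
  turns the nonconvex constraint \<open>z\<^sup>2 \<ge> 4 a b\<close> into a term of known sign; the last square fixes
  \<open>a + b + z\<close> at \<open>4 / N\<close>. The linear terms cancel because the total mass is one.
\<close>
lemma discrepancy_excess:
  fixes n :: nat and p q :: "nat \<Rightarrow> real"
  defines "c \<equiv> sum_prob n p q"
  assumes n: "n \<ge> 2" and pq: "prob_vec n p" "prob_vec n q"
  shows "discrepancy n p q - min_discrepancy n =
      (\<Sum>j\<in>{2..2 * n} - {2, n + 1, 2 * n}. (c j - 3 / (2 * (3 * real n - 2)))\<^sup>2) +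
      1/4 * (c 2 - c (2 * n))\<^sup>2 + 1/4 * ((c (n + 1))\<^sup>2 - 4 * c 2 * c (2 * n)) +
      3/8 * (c 2 + c (2 * n) - c (n + 1))\<^sup>2 +
      3/8 * (c 2 + c (2 * n) + c (n + 1) - 4 / (3 * real n - 2))\<^sup>2"
proof -
  define J where "J = {2..2 * n} - {2, n + 1, 2 * n}"
  define N where "N = 3 * real n - 2"
  define a where "a = c 2"
  define b where "b = c (2 * n)"
  define z where "z = c (n + 1)"
  define s where "s = (\<Sum>j\<in>J. c j)"
  define S where "S = (\<Sum>j\<in>J. (c j)\<^sup>2)"
  have [simp]: "finite J" by (simp add: J_def)
  have split: "(\<Sum>j=2..2 * n. f j) = f 2 + f (2 * n) + f (n + 1) + (\<Sum>j\<in>J. f j)"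
    for f :: "nat \<Rightarrow> real"
  proof -
    have "(\<Sum>j=2..2 * n. f j) = (\<Sum>j\<in>J. f j) + (\<Sum>j\<in>{2, n + 1, 2 * n}. f j)"
      unfolding J_def using n by (intro sum.subset_diff) auto
    then show ?thesis using n by simp
  qed
  have total: "a + b + z + s = 1"
    using split[of c] pq sum_prob_total[of n p q]
    by (simp add: a_def b_def z_def s_def c_def prob_vec_def)
  have cJ: "real (card J) = 2 * real n - 4"
    using split[of "\<lambda>_. 1"] n by (simp add: of_nat_diff)
  have N: "N > 0" "N \<noteq> 0" and M: "2 * real n - 1 \<noteq> 0" using n by (auto simp: N_def)
  have rN: "real n = (N + 2) / 3" by (simp add: N_def)
  have D: "discrepancy n p q = a\<^sup>2 + b\<^sup>2 + z\<^sup>2 + S - 1 / (2 * real n - 1)"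
  proof -
    let ?u = "1 / (2 * real n - 1)"
    have "discrepancy n p q = (\<Sum>j=2..2 * n. (c j)\<^sup>2 - 2 * ?u * c j + ?u\<^sup>2)"
      unfolding discrepancy_def c_def by (intro sum.cong) (auto simp: power2_diff)
    also have "\<dots> = (\<Sum>j=2..2 * n. (c j)\<^sup>2) - 2 * ?u * (\<Sum>j=2..2 * n. c j) + (2 * real n - 1) * ?u\<^sup>2"
      using n by (simp add: sum.distrib sum_subtractf sum_distrib_left of_nat_diff)
    also have "(\<Sum>j=2..2 * n. c j) = 1"
      using split[of c] total by (simp add: a_def b_def z_def s_def)
    also have "(2 * real n - 1) * ?u\<^sup>2 = ?u"
      using M by (simp add: power2_eq_square)
    finally show ?thesis
      using split[of "\<lambda>j. (c j)\<^sup>2"] by (simp add: a_def b_def z_def S_def)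
  qed
  have min: "min_discrepancy n = 3 / (2 * N) - 1 / (2 * real n - 1)"
    unfolding min_discrepancy_def N_def using M N(2)[unfolded N_def]
    by (simp add: field_simps)
  have free: "(\<Sum>j\<in>J. (c j - 3 / (2 * N))\<^sup>2) = S - 3 / N * s + (2 * real n - 4) * (3 / (2 * N))\<^sup>2"
  proof -
    have "(\<Sum>j\<in>J. (c j - 3 / (2 * N))\<^sup>2) = (\<Sum>j\<in>J. (c j)\<^sup>2 - 3 / N * c j + (3 / (2 * N))\<^sup>2)"
      by (intro sum.cong) (auto simp: power2_diff)
    then show ?thesis
      by (simp add: sum.distrib sum_subtractf sum_distrib_left S_def s_def cJ)
  qed
  have s: "s = 1 - a - b - z" using total by simp
  have const: "3 / (2 * N) - (2 * real n - 4) * (3 / (2 * N))\<^sup>2 = 6 / N\<^sup>2"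
    unfolding rN using N by (simp add: field_simps power2_eq_square)
  have ends: "1/4 * (a - b)\<^sup>2 + 1/4 * (z\<^sup>2 - 4 * a * b) + 3/8 * (a + b - z)\<^sup>2 +
      3/8 * (a + b + z - 4 / N)\<^sup>2 = a\<^sup>2 + b\<^sup>2 + z\<^sup>2 - 3 / N * (a + b + z) + 6 / N\<^sup>2"
    using N by (simp add: field_simps power2_eq_square)
  show ?thesis
    unfolding J_def[symmetric] N_def[symmetric] a_def[symmetric] b_def[symmetric] z_def[symmetric]
      D min free
    using ends const unfolding s by (simp add: algebra_simps)
qed

lemma discrepancy_ge:
  assumes "n \<ge> 2" "prob_vec n p" "prob_vec n q"
  shows "min_discrepancy n \<le> discrepancy n p q"
proof -
  have "0 \<le> discrepancy n p q - min_discrepancy n"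
    unfolding discrepancy_excess[OF assms] using middle_square_ge(2)[OF assms]
    by (intro add_nonneg_nonneg sum_nonneg mult_nonneg_nonneg) auto
  then show ?thesis by simp
qed

lemma discrepancy_eq_min_iff:
  assumes "n \<ge> 2" "prob_vec n p" "prob_vec n q"
  shows "discrepancy n p q = min_discrepancy n \<longleftrightarrow> optimal_profile n (sum_prob n p q)"
proof
  let ?c = "sum_prob n p q"
  let ?J = "{2..2 * n} - {2, n + 1, 2 * n}"
  let ?S = "\<Sum>j\<in>?J. (?c j - 3 / (2 * (3 * real n - 2)))\<^sup>2"
  assume "discrepancy n p q = min_discrepancy n"
  then have zero: "?S + 1/4 * (?c 2 - ?c (2 * n))\<^sup>2 + 1/4 * ((?c (n + 1))\<^sup>2 - 4 * ?c 2 * ?c (2 * n)) +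
      3/8 * (?c 2 + ?c (2 * n) - ?c (n + 1))\<^sup>2 +
      3/8 * (?c 2 + ?c (2 * n) + ?c (n + 1) - 4 / (3 * real n - 2))\<^sup>2 = 0"
    using discrepancy_excess[OF assms] by simp
  have terms: "S = 0 \<and> A = 0 \<and> C = 0 \<and> E = 0"
    if "S + 1/4 * A + 1/4 * B + 3/8 * C + 3/8 * E = 0"
      "S \<ge> 0" "A \<ge> 0" "B \<ge> 0" "C \<ge> 0" "E \<ge> 0" for S A B C E :: real
    using that by linarith
  have "?S \<ge> 0" by (intro sum_nonneg) auto
  then have zeros: "?S = 0" "(?c 2 - ?c (2 * n))\<^sup>2 = 0" "(?c 2 + ?c (2 * n) - ?c (n + 1))\<^sup>2 = 0"
      "(?c 2 + ?c (2 * n) + ?c (n + 1) - 4 / (3 * real n - 2))\<^sup>2 = 0"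
    using terms[OF zero _ zero_le_power2 _ zero_le_power2 zero_le_power2] middle_square_ge(2)[OF assms]
    by (blast intro: diff_ge_0_iff_ge[THEN iffD2])+
  from zeros(1) have "\<forall>j\<in>?J. ?c j = 3 / (2 * (3 * real n - 2))"
    by (subst (asm) sum_nonneg_eq_0_iff) auto
  moreover have "?c 2 - ?c (2 * n) = 0" "?c 2 + ?c (2 * n) - ?c (n + 1) = 0"
      "?c 2 + ?c (2 * n) + ?c (n + 1) - 4 / (3 * real n - 2) = 0"
    using zeros(2-4) by (simp_all only: power_eq_0_iff)
  moreover have "a = 1 / N \<and> b = 1 / N \<and> z = 2 / N"
    if "a - b = 0" "a + b - z = 0" "a + b + z - 4 / N = 0" for a b z N :: real
  proof -
    have "4 / N = 4 * (1 / N)" "2 / N = 2 * (1 / N)" by simp_all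
    then show ?thesis using that by linarith
  qed
  ultimately show "optimal_profile n ?c"
    unfolding optimal_profile_def by blast
next
  assume "optimal_profile n (sum_prob n p q)"
  then have "discrepancy n p q - min_discrepancy n = 0"
    unfolding discrepancy_excess[OF assms] optimal_profile_def
    by (simp add: power2_eq_square)
  then show "discrepancy n p q = min_discrepancy n" by simp
qed

section \<open>The dice that realize the optimal distribution\<close>

definition extremal_pair :: "nat \<Rightarrow> (nat \<Rightarrow> real) \<Rightarrow> (nat \<Rightarrow> real) \<Rightarrow> bool" where
  "extremal_pair n p q \<longleftrightarrow>
     p 1 = 1 / 2 \<and> p n = 1 / 2 \<and> (\<forall>i\<in>{2..n - 1}. p i = 0) \<and>
     q 1 = 2 / (3 * real n - 2) \<and> q n = 2 / (3 * real n - 2) \<and>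
     (\<forall>i\<in>{2..n - 1}. q i = 3 / (3 * real n - 2))"

lemma optimal_profile_le:
  assumes "n \<ge> 2" "optimal_profile n c" "j \<in> {2..2 * n}"
  shows "c j \<le> 2 / (3 * real n - 2)"
proof (cases "j \<in> {2, n + 1, 2 * n}")
  case False
  then have "c j = 3 / (2 * (3 * real n - 2))"
    using assms unfolding optimal_profile_def by blast
  then show ?thesis using assms(1) by (simp add: field_simps)
qed (use assms in \<open>auto simp: optimal_profile_def divide_right_mono\<close>)

text \<open>
  In the optimal distribution the middle value equals \<open>2 sqrt (c\<^sub>2 c\<^sub>2\<^sub>n)\<close>, so both estimates leading
  to \<open>c\<^sub>n\<^sub>+\<^sub>1\<^sup>2 \<ge> 4 c\<^sub>2 c\<^sub>2\<^sub>n\<close> are sharp: \<open>p\<^sub>1 q\<^sub>n\<close> and \<open>p\<^sub>n q\<^sub>1\<close> coincide, and no other pair of sides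
  contributes to \<open>c\<^sub>n\<^sub>+\<^sub>1\<close>.
\<close>
lemma optimal_profile_tight:
  assumes n: "n \<ge> 2" and pq: "prob_vec n p" "prob_vec n q"
    and opt: "optimal_profile n (sum_prob n p q)"
  shows "p 1 > 0" "q 1 > 0" "p n = p 1" "q n = q 1" "p 1 * q 1 = 1 / (3 * real n - 2)"
    and "\<And>i. 1 < i \<Longrightarrow> i < n \<Longrightarrow> p i * q (n + 1 - i) = 0"
proof -
  define x where "x = 1 / (3 * real n - 2)"
  have x: "x > 0" using n by (simp add: x_def)
  have nonneg: "0 \<le> p i" "0 \<le> q i" if "i \<in> {1..n}" for i
    using pq that by (auto simp: prob_vec_def)
  have c: "p 1 * q 1 = x" "p n * q n = x" "sum_prob n p q (n + 1) = 2 * x"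
    using opt n sum_prob_2[of n p q] sum_prob_2n[of n p q] by (auto simp: optimal_profile_def x_def)
  show "p 1 * q 1 = 1 / (3 * real n - 2)" using c by (simp add: x_def)
  show p1: "p 1 > 0" and q1: "q 1 > 0"
    using c(1) x nonneg[of 1] n by (auto simp: less_le)
  let ?u = "p 1 * q n" and ?v = "p n * q 1"
  have le: "?u + ?v \<le> 2 * x" using middle_square_ge(1)[OF n pq] c by simp
  have uv: "?u * ?v = x\<^sup>2"
    using c(1,2) by (metis mult.assoc mult.commute power2_eq_square)
  have "(?u + ?v)\<^sup>2 \<le> (2 * x)\<^sup>2"
    using le nonneg n by (intro power_mono add_nonneg_nonneg mult_nonneg_nonneg) auto
  then have "(?u - ?v)\<^sup>2 \<le> 0"
    using uv by (simp add: power2_eq_square algebra_simps)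
  then have "?u = ?v" by simp
  moreover have "0 \<le> ?u" using nonneg n by simp
  ultimately have "?u = x" "?v = x"
    using uv x by (auto simp: power2_eq_square[symmetric] power2_eq_iff_nonneg)
  then show "p n = p 1" "q n = q 1"
    using c(1) p1 q1 by (metis mult_right_cancel mult_left_cancel less_irrefl)+
  fix i assume i: "1 < i" "i < n"
  have "(\<Sum>(i, k)\<in>{(1, n), (n, 1), (i, n + 1 - i)}. p i * q k) \<le> 2 * x"
    unfolding c(3)[symmetric] using i by (intro sum_le_sum_prob pq) auto
  then have "p i * q (n + 1 - i) \<le> 0"
    using i \<open>?u = x\<close> \<open>?v = x\<close> by simp
  then show "p i * q (n + 1 - i) = 0"
    using i by (intro antisym mult_nonneg_nonneg nonneg) auto
qed

text \<open>
  The induction runs from both ends towards the middle, treating the sides \<open>k\<close> and \<open>n + 1 - k\<close>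
  together: if \<open>p\<close> had weight at one of them, then \<open>q\<close> would have none at the opposite one, where
  all the required mass \<open>3 / (2 N)\<close> would have to come from \<open>p\<close>. Combined with the weight of \<open>q\<close> at
  side 2 this would make a value of the distribution at least \<open>9 / (4 N)\<close>.
\<close>
lemma inner_weights_vanish:
  assumes n: "n \<ge> 3" and pq: "prob_vec n p" "prob_vec n q"
    and opt: "optimal_profile n (sum_prob n p q)" and p2: "p 2 = 0"
  shows "1 < k \<Longrightarrow> k < n \<Longrightarrow> p k = 0 \<and> p (n + 1 - k) = 0"
proof (induction k rule: less_induct)
  case (less k)
  define x where "x = 1 / (3 * real n - 2)"
  have x: "x > 0" using n by (simp add: x_def)
  have n2: "n \<ge> 2" using n by simp
  note tight = optimal_profile_tight[OF n2 pq opt]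
  have xeq: "p 1 * q 1 = x" using tight(5) by (simp add: x_def)
  have free: "sum_prob n p q j = 3 / 2 * x" if "j \<in> {2..2 * n} - {2, n + 1, 2 * n}" for j
    using opt that by (auto simp: optimal_profile_def x_def)
  have q2: "p 1 * q 2 = 3 / 2 * x"
    using sum_prob_low[of 2 n p q] free[of 3] n p2 by simp
  have low: "p 1 * q k + p k * q 1 = 3 / 2 * x"
    using sum_prob_low[of k n p q] less free[of "k + 1"] by simp
  have high: "p 1 * q (n + 1 - k) + p (n + 1 - k) * q 1 = 3 / 2 * x"
  proof -
    have "2 * n + 1 - k \<in> {2..2 * n} - {2, n + 1, 2 * n}" using less.prems by auto
    then show ?thesis
      using sum_prob_high[of k n p q] less free[of "2 * n + 1 - k"] tight(3,4) by simp
  qed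
  have bound: "p i * q 1 \<noteq> 3 / 2 * x" if "1 < i" "i < n" for i
  proof
    assume "p i * q 1 = 3 / 2 * x"
    then have "(p i * q 2) * x = 9 / 4 * x * x"
      using q2 unfolding xeq[symmetric] by algebra
    then have "p i * q 2 = 9 / 4 * x" using x by simp
    moreover have "p i * q 2 \<le> sum_prob n p q (i + 2)"
      using sum_le_sum_prob[OF pq, of "{(i, 2)}" "i + 2"] that by simp
    moreover have "sum_prob n p q (i + 2) \<le> 2 * x"
      using optimal_profile_le[OF n2 opt, of "i + 2"] that by (simp add: x_def)
    ultimately show False using x by simp
  qed
  have "p k = 0"
  proof (rule ccontr)
    assume "p k \<noteq> 0"
    then have "q (n + 1 - k) = 0" using tight(6)[of k] less.prems by simp
    moreover have "1 < n + 1 - k" "n + 1 - k < n" using less.prems by auto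
    ultimately show False using high bound by simp
  qed
  moreover have "p (n + 1 - k) = 0"
  proof (rule ccontr)
    assume "p (n + 1 - k) \<noteq> 0"
    then have "q k = 0" using tight(6)[of "n + 1 - k"] less.prems by simp
    then show False using low bound[of k] less.prems by simp
  qed
  ultimately show ?case by simp
qed

text \<open>
  The condition on \<open>p 2\<close> breaks the symmetry between the dice, deciding which of them is the coin;
  for \<open>n = 2\<close> there are no inner sides and both are.
\<close>
lemma extremal_pairI:
  assumes n: "n \<ge> 2" and pq: "prob_vec n p" "prob_vec n q"
    and opt: "optimal_profile n (sum_prob n p q)" and p2: "n \<ge> 3 \<Longrightarrow> p 2 = 0"
  shows "extremal_pair n p q"
proof -
  note tight = optimal_profile_tight[OF n pq opt]
  have inner: "p i = 0" if "1 < i" "i < n" for i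
    using inner_weights_vanish[OF _ pq opt p2, of i] that by simp
  have "(\<Sum>i=1..n. p i) = (\<Sum>i\<in>{1, n}. p i)"
    using n inner by (intro sum.mono_neutral_right) auto
  then have p1: "p 1 = 1 / 2"
    using pq(1) tight(3) n by (simp add: prob_vec_def)
  have "q i = 3 / (3 * real n - 2)" if "i \<in> {2..n - 1}" for i
  proof -
    have "sum_prob n p q (i + 1) = q i / 2"
      using sum_prob_low[of i n p q] inner[of i] inner that unfolding p1 by auto
    moreover have "sum_prob n p q (i + 1) = 3 / (2 * (3 * real n - 2))"
      using opt that unfolding optimal_profile_def by auto
    moreover have "y = 3 / N" if "s = y / 2" "s = 3 / (2 * N)" for s y N :: real
      using that by simp
    ultimately show ?thesis by blast
  qed
  moreover have "q 1 = 2 / (3 * real n - 2)" using tight(5) unfolding p1 by simp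
  ultimately show ?thesis
    unfolding extremal_pair_def using tight(3,4) p1 inner by auto
qed

lemma optimal_profile_imp_extremal_pair:
  assumes n: "n \<ge> 2" and pq: "prob_vec n p" "prob_vec n q"
    and opt: "optimal_profile n (sum_prob n p q)"
  shows "extremal_pair n p q \<or> extremal_pair n q p"
proof -
  have "p 2 = 0 \<or> q 2 = 0" if n3: "n \<ge> 3"
  proof (rule ccontr)
    assume neq: "\<not> (p 2 = 0 \<or> q 2 = 0)"
    \<comment> \<open>Then both dice have no weight at side \<open>n - 1\<close>, and the sum \<open>2 n - 1\<close> cannot occur.\<close>
    note tight = optimal_profile_tight[OF n pq opt]
    have "q (n - 1) = 0" "p (n - 1) = 0"
      using tight(6)[of 2] tight(6)[of "n - 1"] neq n3 by (auto simp: numeral_2_eq_2)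
    then have "sum_prob n p q (2 * n - 1) = 0"
      using sum_prob_high[of 2 n p q] n3 by (auto simp: numeral_2_eq_2)
    moreover have "2 * n - 1 \<in> {2..2 * n} - {2, n + 1, 2 * n}" using n3 by auto
    then have "sum_prob n p q (2 * n - 1) = 3 / (2 * (3 * real n - 2))"
      using opt unfolding optimal_profile_def by blast
    ultimately show False using n3 by simp
  qed
  moreover have "optimal_profile n (sum_prob n q p)"
    using opt by (metis sum_prob_commute)
  ultimately show ?thesis
    using extremal_pairI[OF n pq opt] extremal_pairI[OF n pq(2,1)] by blast
qed

lemma extremal_pair_imp_optimal_profile:
  assumes n: "n \<ge> 2" and ext: "extremal_pair n p q"
  shows "optimal_profile n (sum_prob n p q)"
proof -
  have p: "p 1 = 1 / 2" "p n = 1 / 2" and q1: "q 1 = 2 / (3 * real n - 2)" "q n = 2 / (3 * real n - 2)"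
    and inner: "\<And>i. 1 < i \<Longrightarrow> i < n \<Longrightarrow> p i = 0"
    and qi: "\<And>i. 1 < i \<Longrightarrow> i < n \<Longrightarrow> q i = 3 / (3 * real n - 2)"
    using ext by (auto simp: extremal_pair_def)
  have "sum_prob n p q 2 = 1 / (3 * real n - 2)" "sum_prob n p q (2 * n) = 1 / (3 * real n - 2)"
    using sum_prob_2[of n p q] sum_prob_2n[of n p q] n p q1 by simp_all
  moreover have "sum_prob n p q (n + 1) = 2 / (3 * real n - 2)"
    using sum_prob_low[of n n p q] inner n unfolding p q1 by simp
  moreover have "sum_prob n p q j = 3 / (2 * (3 * real n - 2))"
    if "j \<in> {2..2 * n} - {2, n + 1, 2 * n}" for j
  proof (cases "j \<le> n")
    case True
    define k where "k = j - 1"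
    have k: "1 < k" "k < n" "j = k + 1" using True that by (auto simp: k_def)
    then have "sum_prob n p q j = 1 / 2 * (3 / (3 * real n - 2))"
      using sum_prob_low[of k n p q] inner qi[of k] unfolding p(1) by simp
    then show ?thesis by (simp only: times_divide_times_eq mult_1)
  next
    case False
    define k where "k = 2 * n + 1 - j"
    have k: "1 < k" "k < n" "j = 2 * n + 1 - k" using False that by (auto simp: k_def)
    then have k': "1 < n + 1 - k" "n + 1 - k < n" by auto
    have "sum_prob n p q j = 1 / 2 * (3 / (3 * real n - 2))"
      using sum_prob_high[of k n p q] inner[OF k'] inner k unfolding p(2) qi[OF k'] by simp
    then show ?thesis by (simp only: times_divide_times_eq mult_1)
  qed
  ultimately show ?thesis unfolding optimal_profile_def by blast
qed

lemma optimal_profile_iff_extremal_pair: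
  assumes "n \<ge> 2" "prob_vec n p" "prob_vec n q"
  shows "optimal_profile n (sum_prob n p q) \<longleftrightarrow> extremal_pair n p q \<or> extremal_pair n q p"
  using optimal_profile_imp_extremal_pair[OF assms] extremal_pair_imp_optimal_profile[OF assms(1)]
    sum_prob_commute[of n p q]
  by metis

lemma extremal_pair_exists:
  assumes n: "n \<ge> 2"
  shows "\<exists>p q. prob_vec n p \<and> prob_vec n q \<and> extremal_pair n p q"
proof -
  define p where "p = (\<lambda>i. if i = 1 \<or> i = n then 1 / 2 else (0::real))"
  define q where "q = (\<lambda>i. if i = 1 \<or> i = n then 2 / (3 * real n - 2) else 3 / (3 * real n - 2))"
  have split: "(\<Sum>i=1..n. f i) = f 1 + f n + (\<Sum>i\<in>{2..n - 1}. f i)" for f :: "nat \<Rightarrow> real"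
  proof -
    have "{1..n} = insert 1 (insert n {2..n - 1})" using n by auto
    then show ?thesis using n by (simp del: One_nat_def)
  qed
  have "(\<Sum>i\<in>{2..n - 1}. p i) = 0" by (intro sum.neutral) (auto simp: p_def)
  then have "prob_vec n p"
    unfolding prob_vec_def split by (auto simp: p_def)
  moreover have inner: "(\<Sum>i\<in>{2..n - 1}. q i) = (real n - 2) * (3 / (3 * real n - 2))"
  proof -
    have "(\<Sum>i\<in>{2..n - 1}. q i) = (\<Sum>i\<in>{2..n - 1}. 3 / (3 * real n - 2))"
      using n by (intro sum.cong) (auto simp: q_def)
    then show ?thesis using n by (simp add: of_nat_diff)
  qed
  have "(\<Sum>i=1..n. q i) = 1"
  proof -
    have "2 * (2 / N) + (real n - 2) * (3 / N) = 1" if "N = 3 * real n - 2" "N \<noteq> 0" for N :: real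
      using that by (simp add: field_simps)
    from this[of "3 * real n - 2"] show ?thesis
      unfolding split inner using n by (simp add: q_def)
  qed
  then have "prob_vec n q"
    unfolding prob_vec_def using n by (simp add: q_def)
  moreover have "extremal_pair n p q"
    by (auto simp: extremal_pair_def p_def q_def)
  ultimately show ?thesis by blast
qed

section \<open>The minimizers\<close>

lemma minimizes_discrepancy_iff:
  assumes n: "n \<ge> 2"
  shows "minimizes_discrepancy n p q \<longleftrightarrow>
    prob_vec n p \<and> prob_vec n q \<and> discrepancy n p q = min_discrepancy n"
proof -
  obtain p' q' where *: "prob_vec n p'" "prob_vec n q'" "extremal_pair n p' q'"
    using extremal_pair_exists[OF n] by blast
  have attained: "discrepancy n p' q' = min_discrepancy n"
    using discrepancy_eq_min_iff[OF n *(1,2)] extremal_pair_imp_optimal_profile[OF n *(3)] by blast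
  have "minimizes_discrepancy n p q \<longleftrightarrow> (prob_vec n p \<and> prob_vec n q) \<and>
      (\<forall>p' q'. prob_vec n p' \<and> prob_vec n q' \<longrightarrow> discrepancy n p q \<le> discrepancy n p' q')"
    by (auto simp: minimizes_discrepancy_def is_arg_min_def not_less)
  also have "\<dots> \<longleftrightarrow> prob_vec n p \<and> prob_vec n q \<and> discrepancy n p q = min_discrepancy n"
    using discrepancy_ge[OF n] attained *(1,2) by (metis order.antisym)
  finally show ?thesis .
qed

theorem theorem1:
  fixes n :: nat
  assumes "n \<ge> 2"
  shows
    "(\<exists>p q. minimizes_discrepancy n p q) \<and>
     (\<forall>p q. prob_vec n p \<and> prob_vec n q \<longrightarrow>
        (minimizes_discrepancy n p q \<longleftrightarrow>
           (p 1 = 1 / 2 \<and> p n = 1 / 2 \<and> (\<forall>i\<in>{2..n - 1}. p i = 0) \<and>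
            q 1 = 2 / (3 * real n - 2) \<and> q n = 2 / (3 * real n - 2) \<and>
            (\<forall>i\<in>{2..n - 1}. q i = 3 / (3 * real n - 2)))
         \<or> (q 1 = 1 / 2 \<and> q n = 1 / 2 \<and> (\<forall>i\<in>{2..n - 1}. q i = 0) \<and>
            p 1 = 2 / (3 * real n - 2) \<and> p n = 2 / (3 * real n - 2) \<and>
            (\<forall>i\<in>{2..n - 1}. p i = 3 / (3 * real n - 2))))) \<and>
     (\<forall>p q. minimizes_discrepancy n p q \<longrightarrow>
        discrepancy n p q = 1 / (2 * (2 * real n - 1) * (3 * real n - 2)) \<and>
        sum_prob n p q 2 = 1 / (3 * real n - 2) \<and>
        sum_prob n p q (2 * n) = 1 / (3 * real n - 2) \<and>
        sum_prob n p q (n + 1) = 2 / (3 * real n - 2) \<and>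
        (\<forall>j\<in>{2..2 * n} - {2, n + 1, 2 * n}.
           sum_prob n p q j = 3 / (2 * (3 * real n - 2))))"
proof -
  have iff: "minimizes_discrepancy n p q \<longleftrightarrow> extremal_pair n p q \<or> extremal_pair n q p"
    if "prob_vec n p" "prob_vec n q" for p q
    using that assms
    by (simp add: minimizes_discrepancy_iff discrepancy_eq_min_iff optimal_profile_iff_extremal_pair)
  have "\<exists>p q. minimizes_discrepancy n p q"
    using extremal_pair_exists[OF assms] iff by blast
  moreover have "discrepancy n p q = min_discrepancy n \<and> optimal_profile n (sum_prob n p q)"
    if "minimizes_discrepancy n p q" for p q
    using that assms minimizes_discrepancy_iff discrepancy_eq_min_iff by blast
  ultimately have
    "(\<exists>p q. minimizes_discrepancy n p q) \<and>
     (\<forall>p q. prob_vec n p \<and> prob_vec n q \<longrightarrow>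
        (minimizes_discrepancy n p q \<longleftrightarrow> extremal_pair n p q \<or> extremal_pair n q p)) \<and>
     (\<forall>p q. minimizes_discrepancy n p q \<longrightarrow>
        discrepancy n p q = min_discrepancy n \<and> optimal_profile n (sum_prob n p q))"
    using iff by (intro conjI allI impI) simp_all
  then show ?thesis
    unfolding extremal_pair_def optimal_profile_def min_discrepancy_def .
qed

end
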